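(* Let $n \geq 2$. Then the Brin-Thompson group $nV$ contains continuum many copies of the additive group of the rationals $\mathbb{Q}$ sharing a subgroup isomorphic to $\mathbb{Z}$; that is, there exist a subgroup $Z \leq nV$ isomorphic to $\mathbb{Z}$ and a family of $2^{\aleph_0}$ pairwise distinct subgroups of $nV$, each isomorphic to $(\mathbb{Q},+)$ and each containing $Z$.
   Context: Let $\mathcal{C} = \{0,1\}^{\mathbb{N}}$ be the Cantor set of infinite binary strings. A dyadic subinterval of $\mathcal{C}$ is a set $\{\alpha\omega : \omega \in \{0,1\}^{\mathbb{N}}\}$ for a fixed finite (possibly empty) binary word $\alpha$. A dyadic subblock of $\mathcal{C}^n$ is a product of $n$ dyadic subintervals. A dyadic block is a finite collection $X = \{X_i\}$ of pairwise disjoint dyadic subblocks whose union is $\mathcal{C}^n$; $|X|$ is its number of members. For two dyadic subblocks $A = \prod_j \{\alpha_j\omega\}$ and $B = \prod_j \{\beta_j\omega\}$, the canonical affine map $A \to B$ replaces the prefix $\alpha_j$ by $\beta_j$ in the $j$-th coordinate for each $j$. A triple $(X,Y,\sigma)$ of dyadic blocks $X=\{X_i\}$, $Y=\{Y_j\}$ with $|X|=|Y|=m$ and a permutation $\sigma \in \mathfrak{S}_m$ induces the self-homeomorphism of $\mathcal{C}^n$ that maps $X_i$ onto $Y_{\sigma(i)}$ by the canonical affine map for each $i$. The Brin-Thompson group $nV$ is the group of all self-homeomorphisms of $\mathcal{C}^n$ induced by such triples, with multiplication $gh = h\circ g$. *)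

theory Defs
  imports
    "HOL-Analysis.Analysis"
    "HOL-Algebra.Elementary_Groups"
    "HOL-Library.Omega_Words_Fun"
    "HOL-Library.Equipollence"
begin

text \<open>
  The topology on the Cantor set and on its powers is the library's product topology on
  function types, with \<^typ>\<open>bool\<close> discrete. The power \<open>\<C>\<^sup>n\<close> is indexed by a
  finite type \<open>'n\<close> with \<open>n = CARD('n)\<close>.
\<close>

type_synonym cantor = "bool word"

type_synonym 'n cantor_power = "'n \<Rightarrow> cantor"

definition dyadic_subinterval :: "bool list \<Rightarrow> cantor set" where
  "dyadic_subinterval \<alpha> = {\<alpha> \<frown> \<omega> |\<omega>. True}"

definition dyadic_subblock :: "('n \<Rightarrow> bool list) \<Rightarrow> 'n cantor_power set" where
  "dyadic_subblock \<alpha> = {x. \<forall>j. x j \<in> dyadic_subinterval (\<alpha> j)}"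

text \<open>
  A dyadic block is given as a family of words, its members being
  \<open>dyadic_subblock (X i)\<close> for \<open>i < m\<close>. Subblocks are nonempty, so disjointness makes the
  members distinct and \<open>m\<close> is their number; a subblock determines its words.
\<close>

definition dyadic_block :: "nat \<Rightarrow> (nat \<Rightarrow> 'n \<Rightarrow> bool list) \<Rightarrow> bool" where
  "dyadic_block m X \<longleftrightarrow>
     disjoint_family_on (\<lambda>i. dyadic_subblock (X i)) {..<m} \<and>
     (\<Union>i<m. dyadic_subblock (X i)) = UNIV"

definition canonical_affine ::
    "('n \<Rightarrow> bool list) \<Rightarrow> ('n \<Rightarrow> bool list) \<Rightarrow> 'n cantor_power \<Rightarrow> 'n cantor_power" where
  "canonical_affine \<alpha> \<beta> x = (\<lambda>j. \<beta> j \<frown> suffix (length (\<alpha> j)) (x j))"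

lemma canonical_affine_conc:
  "canonical_affine \<alpha> \<beta> (\<lambda>j. \<alpha> j \<frown> \<omega> j) = (\<lambda>j. \<beta> j \<frown> \<omega> j)"
  by (simp add: canonical_affine_def)

definition induced_by ::
    "nat \<Rightarrow> (nat \<Rightarrow> 'n \<Rightarrow> bool list) \<Rightarrow> (nat \<Rightarrow> 'n \<Rightarrow> bool list) \<Rightarrow> (nat \<Rightarrow> nat) \<Rightarrow>
     ('n cantor_power \<Rightarrow> 'n cantor_power) \<Rightarrow> bool" where
  "induced_by m X Y \<sigma> f \<longleftrightarrow>
     dyadic_block m X \<and> dyadic_block m Y \<and> \<sigma> permutes {..<m} \<and>
     (\<forall>i<m. \<forall>x \<in> dyadic_subblock (X i). f x = canonical_affine (X i) (Y (\<sigma> i)) x)"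

definition brin_thompson :: "('n cantor_power \<Rightarrow> 'n cantor_power) monoid" where
  "brin_thompson =
     \<lparr>carrier = {f. (\<exists>g. homeomorphism UNIV UNIV f g) \<and> (\<exists>m X Y \<sigma>. induced_by m X Y \<sigma> f)},
      monoid.mult = (\<lambda>g h. h \<circ> g),
      one = id\<rparr>"

definition rational_group :: "rat monoid" where
  "rational_group = \<lparr>carrier = UNIV, monoid.mult = (+), one = 0\<rparr>"

end

theory Submission
  imports Defs
begin

text \<open>
  Write the first \<open>N\<close> digits of a mixed radix expansion with radices \<open>2, 3, 4, \<dots>\<close> as a code word of a
  complete prefix code with \<open>(N + 1)!\<close> members. Adding \<open>1\<close> to the code word in one coordinate, and
  letting the overflow act on a second coordinate by an element \<open>a\<close> of infinite order, gives a root
  of order \<open>(N + 1)!\<close> of the map \<open>z\<close> that applies \<open>a\<close> to the second coordinate. Refining the code by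
  one further, least significant, digit extracts a root of this root, so the union of the resulting
  cyclic groups is a copy of \<open>\<rat>\<close> containing \<open>z\<close>. At every refinement the order of the new digit
  may be reversed. Since roots are unique in \<open>\<rat>\<close>, two choices that first differ at some refinement
  yield groups with different roots of \<open>z\<close> at that stage.
\<close>

subsection \<open>Locally affine maps\<close>

lemma dyadic_subinterval_iff_nth:
  "x \<in> dyadic_subinterval \<alpha> \<longleftrightarrow> (\<forall>i<length \<alpha>. x i = \<alpha> ! i)"
proof
  assume "\<forall>i<length \<alpha>. x i = \<alpha> ! i"
  then have "prefix (length \<alpha>) x = \<alpha>"
    by (intro nth_equalityI) auto
  then show "x \<in> dyadic_subinterval \<alpha>"
    unfolding dyadic_subinterval_def using prefix_suffix[of x "length \<alpha>"] by auto
qed (auto simp: dyadic_subinterval_def)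

lemma conc_in_dyadic_subinterval [simp]: "\<alpha> \<frown> \<omega> \<in> dyadic_subinterval \<alpha>"
  by (auto simp: dyadic_subinterval_def)

lemma dyadic_subintervalE:
  assumes "x \<in> dyadic_subinterval \<alpha>"
  obtains \<omega> where "x = \<alpha> \<frown> \<omega>"
  using assms by (auto simp: dyadic_subinterval_def)

lemma conc_in_dyadic_subinterval_shorterE:
  assumes "\<alpha> \<frown> \<omega> \<in> dyadic_subinterval u" "length u \<le> length \<alpha>"
  obtains \<gamma> where "\<alpha> = u @ \<gamma>"
proof
  have "take (length u) \<alpha> = u"
    using assms by (intro nth_equalityI) (auto simp: dyadic_subinterval_iff_nth)
  then show "\<alpha> = u @ drop (length u) \<alpha>"
    by (metis append_take_drop_id)
qed

lemma dyadic_subinterval_appendD: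
  "x \<in> dyadic_subinterval (u @ v) \<Longrightarrow> x \<in> dyadic_subinterval u"
  by (auto simp: dyadic_subinterval_iff_nth nth_append)

lemma dyadic_subblock_iff: "x \<in> dyadic_subblock \<alpha> \<longleftrightarrow> (\<exists>\<omega>. x = (\<lambda>j. \<alpha> j \<frown> \<omega> j))"
proof
  assume "x \<in> dyadic_subblock \<alpha>"
  then have "\<forall>j. \<exists>\<omega>. x j = \<alpha> j \<frown> \<omega>"
    by (auto simp: dyadic_subblock_def dyadic_subinterval_def)
  then show "\<exists>\<omega>. x = (\<lambda>j. \<alpha> j \<frown> \<omega> j)"
    by (metis ext)
qed (auto simp: dyadic_subblock_def)

lemma continuous_on_cantor_power_coordinate:
  "continuous_on S (\<lambda>x :: 'n cantor_power. x j i)"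
  by (rule continuous_on_product_then_coordinatewise, rule continuous_on_product_then_coordinatewise,
      rule continuous_on_id)

lemma open_dyadic_subblock:
  fixes \<alpha> :: "'n::finite \<Rightarrow> bool list"
  shows "open (dyadic_subblock \<alpha>)"
proof -
  have "open {x :: 'n cantor_power. x j i = \<alpha> j ! i}" for j i
  proof -
    have "open ((\<lambda>x :: 'n cantor_power. x j i) -` {\<alpha> j ! i})"
      by (intro open_vimage open_discrete continuous_on_cantor_power_coordinate)
    then show ?thesis
      by (simp add: vimage_def)
  qed
  then have "open (\<Inter>j. \<Inter>i\<in>{..<length (\<alpha> j)}. {x :: 'n cantor_power. x j i = \<alpha> j ! i})"
    by (intro open_INT) auto
  also have "(\<Inter>j. \<Inter>i\<in>{..<length (\<alpha> j)}. {x :: 'n cantor_power. x j i = \<alpha> j ! i}) = dyadic_subblock \<alpha>"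
    by (auto simp: dyadic_subblock_def dyadic_subinterval_iff_nth)
  finally show ?thesis .
qed

text \<open>Each digit of the image is either a constant or a single digit of the argument.\<close>

lemma continuous_on_canonical_affine: "continuous_on UNIV (canonical_affine \<alpha> \<beta>)"
proof (intro continuous_on_coordinatewise_then_product)
  fix j i
  show "continuous_on UNIV (\<lambda>x. canonical_affine \<alpha> \<beta> x j i)"
    unfolding canonical_affine_def
    by (cases "i < length (\<beta> j)") (simp_all add: continuous_on_cantor_power_coordinate)
qed

text \<open>Prefix replacement at a uniform depth, with no block mentioned; for a bijection this
  already yields an inducing triple.\<close>

definition locally_affine :: "nat \<Rightarrow> ('n cantor_power \<Rightarrow> 'n cantor_power) \<Rightarrow> bool" where
  "locally_affine N f \<longleftrightarrow>
     (\<forall>\<alpha>. (\<forall>j. N \<le> length (\<alpha> j)) \<longrightarrow> (\<exists>\<beta>. \<forall>\<omega>. f (\<lambda>j. \<alpha> j \<frown> \<omega> j) = (\<lambda>j. \<beta> j \<frown> \<omega> j)))"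

lemma locally_affineE:
  assumes "locally_affine N f" "\<And>j. N \<le> length (\<alpha> j)"
  obtains \<beta> where "\<And>\<omega>. f (\<lambda>j. \<alpha> j \<frown> \<omega> j) = (\<lambda>j. \<beta> j \<frown> \<omega> j)"
  using assms unfolding locally_affine_def by metis

definition words_of_length :: "nat \<Rightarrow> ('n \<Rightarrow> bool list) set" where
  "words_of_length N = {\<alpha>. \<forall>j. length (\<alpha> j) = N}"

lemma finite_words_of_length: "finite (words_of_length N :: ('n::finite \<Rightarrow> bool list) set)"
proof -
  have "finite (\<Pi>\<^sub>E j\<in>(UNIV::'n set). {w::bool list. set w \<subseteq> UNIV \<and> length w = N})"
    by (intro finite_PiE finite_lists_length_eq) auto
  then show ?thesis
    by (simp add: words_of_length_def PiE_def Pi_def)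
qed

lemma Union_words_of_length: "(\<Union>\<alpha>\<in>words_of_length N. dyadic_subblock \<alpha>) = UNIV"
proof -
  have "x \<in> (\<Union>\<alpha>\<in>words_of_length N. dyadic_subblock \<alpha>)" for x :: "'a cantor_power"
  proof
    show "(\<lambda>j. prefix N (x j)) \<in> words_of_length N"
      by (simp add: words_of_length_def)
    show "x \<in> dyadic_subblock (\<lambda>j. prefix N (x j))"
      by (simp add: dyadic_subblock_def dyadic_subinterval_iff_nth)
  qed
  then show ?thesis by blast
qed

lemma words_of_length_eqI:
  assumes "\<alpha> \<in> words_of_length N" "\<beta> \<in> words_of_length N"
    and "x \<in> dyadic_subblock \<alpha>" "x \<in> dyadic_subblock \<beta>"
  shows "\<alpha> = \<beta>"
proof
  fix j
  show "\<alpha> j = \<beta> j"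
    using assms by (intro nth_equalityI)
      (auto simp: words_of_length_def dyadic_subblock_def dyadic_subinterval_iff_nth)
qed

text \<open>The subblocks given by words of length \<open>N\<close> are open and cover the space,
  and on each of them \<open>f\<close> is a canonical affine map.\<close>

lemma locally_affine_imp_continuous:
  fixes f :: "'n::finite cantor_power \<Rightarrow> 'n cantor_power"
  assumes "locally_affine N f"
  shows "continuous_on UNIV f"
proof -
  have "continuous_on (dyadic_subblock \<alpha>) f" if "\<alpha> \<in> words_of_length N" for \<alpha>
  proof -
    obtain \<beta> where \<beta>: "\<And>\<omega>. f (\<lambda>j. \<alpha> j \<frown> \<omega> j) = (\<lambda>j. \<beta> j \<frown> \<omega> j)"
      using locally_affineE[OF assms, of \<alpha>] \<open>\<alpha> \<in> words_of_length N\<close>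
      by (auto simp: words_of_length_def)
    have "continuous_on (dyadic_subblock \<alpha>) (canonical_affine \<alpha> \<beta>)"
      using continuous_on_canonical_affine continuous_on_subset by blast
    then show ?thesis
      by (rule continuous_on_eq) (auto simp: dyadic_subblock_iff canonical_affine_conc \<beta>)
  qed
  then have "continuous_on (\<Union>\<alpha>\<in>words_of_length N. dyadic_subblock \<alpha>) f"
    by (intro continuous_on_open_UN open_dyadic_subblock)
  then show ?thesis
    by (simp only: Union_words_of_length)
qed

text \<open>
  All words of length \<open>N\<close> serve as source block, and the target block is numbered by them, so the
  permutation is the identity.
\<close>

lemma locally_affine_imp_induced_by:
  fixes f :: "'n::finite cantor_power \<Rightarrow> 'n cantor_power"
  assumes "locally_affine N f" "bij f"
  shows "\<exists>m X Y \<sigma>. induced_by m X Y \<sigma> f"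
proof -
  let ?W = "words_of_length N :: ('n \<Rightarrow> bool list) set"
  obtain X where X: "bij_betw X {..<card ?W} ?W"
    using ex_bij_betw_nat_finite[OF finite_words_of_length] by (auto simp: lessThan_atLeast0)
  have XW: "X i \<in> ?W" if "i < card ?W" for i
    using X that by (auto simp: bij_betw_def)
  have "\<forall>i. \<exists>\<beta>. i < card ?W \<longrightarrow> (\<forall>\<omega>. f (\<lambda>j. X i j \<frown> \<omega> j) = (\<lambda>j. \<beta> j \<frown> \<omega> j))"
  proof (intro allI)
    fix i
    show "\<exists>\<beta>. i < card ?W \<longrightarrow> (\<forall>\<omega>. f (\<lambda>j. X i j \<frown> \<omega> j) = (\<lambda>j. \<beta> j \<frown> \<omega> j))"
      using XW[of i] assms(1) unfolding locally_affine_def words_of_length_def by auto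
  qed
  then obtain Y where
    Y: "\<And>i \<omega>. i < card ?W \<Longrightarrow> f (\<lambda>j. X i j \<frown> \<omega> j) = (\<lambda>j. Y i j \<frown> \<omega> j)"
    by (auto dest!: choice simp only:)
  have image: "f ` dyadic_subblock (X i) = dyadic_subblock (Y i)" if "i < card ?W" for i
    unfolding set_eq_iff image_iff Bex_def dyadic_subblock_iff using Y[OF that] by metis
  have disjX: "disjoint_family_on (\<lambda>i. dyadic_subblock (X i)) {..<card ?W}"
  proof (unfold disjoint_family_on_def, intro ballI impI)
    fix i j assume "i \<in> {..<card ?W}" "j \<in> {..<card ?W}" "i \<noteq> j"
    then have "X i \<in> ?W" "X j \<in> ?W" "X i \<noteq> X j"
      using XW inj_onD[OF bij_betw_imp_inj_on[OF X]] by auto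
    then show "dyadic_subblock (X i) \<inter> dyadic_subblock (X j) = {}"
      using words_of_length_eqI by blast
  qed
  have "(\<Union>i<card ?W. dyadic_subblock (X i)) = \<Union> (dyadic_subblock ` X ` {..<card ?W})"
    by (simp only: image_image)
  then have UnX: "(\<Union>i<card ?W. dyadic_subblock (X i)) = UNIV"
    by (simp only: bij_betw_imp_surj_on[OF X] Union_words_of_length)
  \<comment> \<open>The target subblocks are the images of the source subblocks: injectivity of
    \<open>f\<close> keeps them disjoint, surjectivity makes them cover.\<close>
  have "disjoint_family_on (\<lambda>i. dyadic_subblock (Y i)) {..<card ?W}"
    using disjX unfolding disjoint_family_on_def
    by (simp flip: image add: image_Int[OF bij_is_inj[OF assms(2)], symmetric])
  moreover have "(\<Union>i<card ?W. dyadic_subblock (Y i)) = UNIV"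
  proof -
    have "(\<Union>i<card ?W. dyadic_subblock (Y i)) = f ` (\<Union>i<card ?W. dyadic_subblock (X i))"
      unfolding image_UN by (intro SUP_cong refl) (simp add: image)
    also have "\<dots> = UNIV"
      using UnX bij_is_surj[OF assms(2)] by simp
    finally show ?thesis .
  qed
  moreover have "f x = canonical_affine (X i) (Y (id i)) x"
    if "i < card ?W" "x \<in> dyadic_subblock (X i)" for i x
    using that by (auto simp: dyadic_subblock_iff canonical_affine_conc Y)
  ultimately have "induced_by (card ?W) X Y id f"
    using disjX UnX unfolding induced_by_def dyadic_block_def by (simp only: permutes_id) blast
  then show ?thesis by (intro exI)
qed

section \<open>Elements and subgroups of the Brin-Thompson group\<close>

lemma in_brin_thompsonI:
  fixes f g :: "'n::finite cantor_power \<Rightarrow> 'n cantor_power"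
  assumes "locally_affine N f" "locally_affine N' g" "f \<circ> g = id" "g \<circ> f = id"
  shows "f \<in> carrier brin_thompson"
proof -
  have "bij f" "bij g"
    using assms(3,4) o_bij by blast+
  \<comment> \<open>Local affinity of \<open>g\<close> supplies continuity of the inverse.\<close>
  have "homeomorphism UNIV UNIV f g"
    unfolding homeomorphism_def
    using assms(3,4) locally_affine_imp_continuous[OF assms(1)] locally_affine_imp_continuous[OF assms(2)]
      bij_is_surj[OF \<open>bij f\<close>] bij_is_surj[OF \<open>bij g\<close>]
    by (simp add: pointfree_idE)
  then show ?thesis
    using locally_affine_imp_induced_by[OF assms(1) \<open>bij f\<close>] by (auto simp: brin_thompson_def)
qed

lemma brin_thompson_simps [simp]:
  "mult brin_thompson g h = h \<circ> g" "one brin_thompson = id"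
  by (simp_all add: brin_thompson_def)

text \<open>
  Multiplication in \<^const>\<open>brin_thompson\<close> is composition in reverse order, which does not matter
  here because \<open>H\<close> is commutative.
\<close>

lemma subgroup_range_brin_thompson:
  fixes \<Phi> :: "'a \<Rightarrow> 'n::finite cantor_power \<Rightarrow> 'n cantor_power"
  assumes "comm_group H" "carrier H = UNIV"
    and affine: "\<And>a. \<exists>N. locally_affine N (\<Phi> a)"
    and one: "\<Phi> \<one>\<^bsub>H\<^esub> = id"
    and mult: "\<And>a b. \<Phi> (a \<otimes>\<^bsub>H\<^esub> b) = \<Phi> a \<circ> \<Phi> b"
    and "inj \<Phi>"
  shows "subgroup (range \<Phi>) brin_thompson" "brin_thompson\<lparr>carrier := range \<Phi>\<rparr> \<cong> H"
proof -
  interpret H: comm_group H by fact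
  have inv: "\<Phi> a \<circ> \<Phi> (inv\<^bsub>H\<^esub> a) = id" "\<Phi> (inv\<^bsub>H\<^esub> a) \<circ> \<Phi> a = id" for a
    using assms(2) by (simp_all flip: mult add: one)
  have carrier: "\<Phi> a \<in> carrier brin_thompson" for a
    using affine[of a] affine[of "inv\<^bsub>H\<^esub> a"] in_brin_thompsonI inv by metis
  \<comment> \<open>\<open>m_inv\<close> is a definite description, and the group axioms of
    \<open>brin_thompson\<close> are not established here, so uniqueness of the inverse is checked
    by hand.\<close>
  have m_inv: "inv\<^bsub>brin_thompson\<^esub> (\<Phi> a) = \<Phi> (inv\<^bsub>H\<^esub> a)" for a
    unfolding m_inv_def[of brin_thompson]
  proof (rule the_equality)
    fix g
    assume "g \<in> carrier brin_thompson \<and> \<Phi> a \<otimes>\<^bsub>brin_thompson\<^esub> g = \<one>\<^bsub>brin_thompson\<^esub> \<and>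
      g \<otimes>\<^bsub>brin_thompson\<^esub> \<Phi> a = \<one>\<^bsub>brin_thompson\<^esub>"
    then show "g = \<Phi> (inv\<^bsub>H\<^esub> a)"
      using inv[of a] by (metis brin_thompson_simps comp_assoc comp_id id_comp)
  qed (simp add: carrier inv)
  show "subgroup (range \<Phi>) brin_thompson"
  proof (rule subgroup.intro)
    show "\<one>\<^bsub>brin_thompson\<^esub> \<in> range \<Phi>"
      using rangeI[of \<Phi> "\<one>\<^bsub>H\<^esub>"] by (simp add: one)
    show "inv\<^bsub>brin_thompson\<^esub> x \<in> range \<Phi>" if "x \<in> range \<Phi>" for x
      using that by (auto simp: m_inv)
  qed (auto simp: carrier simp flip: mult)
  have "\<Phi> \<in> hom H (brin_thompson\<lparr>carrier := range \<Phi>\<rparr>)"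
    using assms(2) H.m_comm by (auto simp: hom_def simp flip: mult)
  then have "\<Phi> \<in> iso H (brin_thompson\<lparr>carrier := range \<Phi>\<rparr>)"
    using assms(2) \<open>inj \<Phi>\<close> by (simp add: iso_def bij_betw_def)
  then show "brin_thompson\<lparr>carrier := range \<Phi>\<rparr> \<cong> H"
    using H.iso_sym is_isoI by blast
qed

lemma comm_group_rational_group: "comm_group rational_group"
proof (rule comm_groupI)
  fix x assume "x \<in> carrier rational_group"
  then show "\<exists>y\<in>carrier rational_group. y \<otimes>\<^bsub>rational_group\<^esub> x = \<one>\<^bsub>rational_group\<^esub>"
    by (intro bexI[of _ "- x"]) (auto simp: rational_group_def)
qed (auto simp: rational_group_def)

subsection \<open>Powers of a generator of Thompson's group \<open>F\<close>\<close>

lemma comp_eq_idD: "f \<circ> g = id \<Longrightarrow> f \<circ> (g \<circ> h) = h"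
  by (metis comp_assoc id_comp)

text \<open>Integer iterates of a bijection \<open>f\<close>. Its inverse \<open>g\<close> is passed
  explicitly, so that negative powers are seen to be affine as well.\<close>

definition int_funpow :: "('a \<Rightarrow> 'a) \<Rightarrow> ('a \<Rightarrow> 'a) \<Rightarrow> int \<Rightarrow> 'a \<Rightarrow> 'a" where
  "int_funpow f g c = (if 0 \<le> c then f ^^ nat c else g ^^ nat (- c))"

lemma int_funpow_0: "int_funpow f g 0 = id"
  by (simp add: int_funpow_def)

lemma int_funpow_add1:
  assumes "f \<circ> g = id"
  shows "int_funpow f g (c + 1) = f \<circ> int_funpow f g c"
proof (cases "0 \<le> c")
  case True
  then show ?thesis
    by (simp add: int_funpow_def nat_add_distrib)
next
  case False
  then have "nat (- c) = Suc (nat (- (c + 1)))"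
    by simp
  then show ?thesis
    using False by (auto simp: int_funpow_def comp_eq_idD[OF assms])
qed

lemma int_funpow_add:
  assumes "f \<circ> g = id" "g \<circ> f = id"
  shows "int_funpow f g (c + d) = int_funpow f g c \<circ> int_funpow f g d"
proof (induction c rule: int_induct[where k = 0])
  case base
  then show ?case by (simp add: int_funpow_0)
next
  case (step1 c)
  have "int_funpow f g (c + 1 + d) = f \<circ> int_funpow f g (c + d)"
    using int_funpow_add1[OF assms(1), of "c + d"] by (simp add: ac_simps)
  then show ?case
    using step1 int_funpow_add1[OF assms(1), of c] by (simp add: comp_assoc)
next
  case (step2 c)
  have pred: "int_funpow f g (e - 1) = g \<circ> int_funpow f g e" for e
    using int_funpow_add1[OF assms(1), of "e - 1"] by (simp add: comp_eq_idD[OF assms(2)])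
  have "int_funpow f g (c - 1 + d) = g \<circ> int_funpow f g (c + d)"
    using pred[of "c + d"] by (simp add: algebra_simps)
  then show ?case
    using step2 pred[of c] by (simp add: comp_assoc)
qed

definition cantor_affine :: "nat \<Rightarrow> (cantor \<Rightarrow> cantor) \<Rightarrow> bool" where
  "cantor_affine D f \<longleftrightarrow> (\<forall>\<alpha>. D \<le> length \<alpha> \<longrightarrow> (\<exists>\<beta>. \<forall>\<omega>. f (\<alpha> \<frown> \<omega>) = \<beta> \<frown> \<omega>))"

lemma cantor_affineE:
  assumes "cantor_affine D f" "D \<le> length \<alpha>"
  obtains \<beta> where "\<And>\<omega>. f (\<alpha> \<frown> \<omega>) = \<beta> \<frown> \<omega>"
  using assms unfolding cantor_affine_def by blast

lemma cantor_affine_mono: "cantor_affine D f \<Longrightarrow> D \<le> E \<Longrightarrow> cantor_affine E f"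
  by (auto simp: cantor_affine_def)

text \<open>The first \<open>D\<close> letters are spent on \<open>f\<close>. Its replacement for
  them may be empty, but at least \<open>E\<close> letters remain for \<open>g\<close>.\<close>

lemma cantor_affine_comp:
  assumes "cantor_affine D f" "cantor_affine E g"
  shows "cantor_affine (D + E) (g \<circ> f)"
  unfolding cantor_affine_def
proof (intro allI impI)
  fix \<alpha> :: "bool list" assume len: "D + E \<le> length \<alpha>"
  obtain \<beta> where \<beta>: "\<And>\<omega>. f (take D \<alpha> \<frown> \<omega>) = \<beta> \<frown> \<omega>"
    using cantor_affineE[OF assms(1), of "take D \<alpha>"] len by auto
  have "E \<le> length (\<beta> @ drop D \<alpha>)"
    using len by simp
  then obtain \<gamma> where \<gamma>: "\<And>\<omega>. g ((\<beta> @ drop D \<alpha>) \<frown> \<omega>) = \<gamma> \<frown> \<omega>"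
    using cantor_affineE[OF assms(2)] by blast
  have "(g \<circ> f) (\<alpha> \<frown> \<omega>) = \<gamma> \<frown> \<omega>" for \<omega>
    using \<beta>[of "drop D \<alpha> \<frown> \<omega>"] \<gamma>[of \<omega>] by simp
  then show "\<exists>\<beta>. \<forall>\<omega>. (g \<circ> f) (\<alpha> \<frown> \<omega>) = \<beta> \<frown> \<omega>"
    by blast
qed

lemma cantor_affine_funpow:
  assumes "cantor_affine D f"
  shows "cantor_affine (D * n) (f ^^ n)"
proof (induction n)
  case 0
  then show ?case by (auto simp: cantor_affine_def)
next
  case (Suc n)
  then show ?case
    using cantor_affine_comp[OF Suc assms] by (simp only: funpow.simps mult_Suc_right add.commute)
qed

text \<open>A standard generator of F, up to inversion: the prefixes \<open>00\<close>,
  \<open>01\<close>, \<open>1\<close> become \<open>0\<close>, \<open>10\<close>,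
  \<open>11\<close>.\<close>

definition thompson_x0 :: "cantor \<Rightarrow> cantor" where
  "thompson_x0 x =
     (if x 0 then [True] \<frown> x
      else if x 1 then [True, False] \<frown> suffix 2 x
      else [False] \<frown> suffix 2 x)"

definition thompson_x0_inv :: "cantor \<Rightarrow> cantor" where
  "thompson_x0_inv y =
     (if \<not> y 0 then [False] \<frown> y
      else if y 1 then suffix 1 y
      else [False, True] \<frown> suffix 2 y)"

lemma thompson_x0_inverse:
  "thompson_x0 \<circ> thompson_x0_inv = id" "thompson_x0_inv \<circ> thompson_x0 = id"
proof -
  have "thompson_x0 (thompson_x0_inv x) n = x n" "thompson_x0_inv (thompson_x0 x) n = x n" for x n
    by (cases n; cases "n - 1"; auto simp: thompson_x0_def thompson_x0_inv_def conc_def)+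
  then show "thompson_x0 \<circ> thompson_x0_inv = id" "thompson_x0_inv \<circ> thompson_x0 = id"
    by (simp_all add: fun_eq_iff)
qed

lemma list_ge_2E:
  assumes "2 \<le> length xs"
  obtains a b ys where "xs = [a, b] @ ys"
  using assms by (cases xs; cases "tl xs") auto

lemma cantor_affine_thompson_x0: "cantor_affine 2 thompson_x0" "cantor_affine 2 thompson_x0_inv"
proof -
  show "cantor_affine 2 thompson_x0"
    unfolding cantor_affine_def
  proof (intro allI impI)
    fix \<alpha> :: "bool list" assume "2 \<le> length \<alpha>"
    then obtain a b \<gamma> where \<alpha>: "\<alpha> = [a, b] @ \<gamma>"
      by (rule list_ge_2E)
    have "thompson_x0 (\<alpha> \<frown> \<omega>) =
        (if a then True # \<alpha> else if b then [True, False] @ \<gamma> else False # \<gamma>) \<frown> \<omega>" for \<omega>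
      by (auto simp: thompson_x0_def \<alpha> simp flip: conc_conc)
    then show "\<exists>\<beta>. \<forall>\<omega>. thompson_x0 (\<alpha> \<frown> \<omega>) = \<beta> \<frown> \<omega>" by blast
  qed
  show "cantor_affine 2 thompson_x0_inv"
    unfolding cantor_affine_def
  proof (intro allI impI)
    fix \<alpha> :: "bool list" assume "2 \<le> length \<alpha>"
    then obtain a b \<gamma> where \<alpha>: "\<alpha> = [a, b] @ \<gamma>"
      by (rule list_ge_2E)
    have "thompson_x0_inv (\<alpha> \<frown> \<omega>) =
        (if \<not> a then False # \<alpha> else if b then b # \<gamma> else [False, True] @ \<gamma>) \<frown> \<omega>" for \<omega>
      by (auto simp: thompson_x0_inv_def \<alpha> simp flip: conc_conc)
    then show "\<exists>\<beta>. \<forall>\<omega>. thompson_x0_inv (\<alpha> \<frown> \<omega>) = \<beta> \<frown> \<omega>" by blast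
  qed
qed

text \<open>A string with leading \<open>True\<close> never leaves the branch that prepends
  \<open>True\<close>; infinite order is read off from this.\<close>

lemma thompson_x0_funpow:
  "x 0 \<Longrightarrow> (thompson_x0 ^^ n) x = replicate n True \<frown> x"
proof (induction n)
  case (Suc n)
  then have "(replicate n True \<frown> x) 0"
    by (cases n) auto
  then show ?case
    using Suc by (simp add: thompson_x0_def)
qed simp

abbreviation thompson_x0_power :: "int \<Rightarrow> cantor \<Rightarrow> cantor" where
  "thompson_x0_power \<equiv> int_funpow thompson_x0 thompson_x0_inv"

lemma cantor_affine_thompson_x0_power: "\<exists>D. cantor_affine D (thompson_x0_power c)"
  unfolding int_funpow_def using cantor_affine_funpow cantor_affine_thompson_x0 by auto

text \<open>A positive power lengthens the initial run of ones of \<open>1000...\<close>, so it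
  moves this point. A point fixed by a negative power is also fixed by the inverse, which is a
  positive power.\<close>

lemma thompson_x0_power_fixes_imp_0:
  assumes "thompson_x0_power c (\<lambda>n. n = 0) = (\<lambda>n. n = 0)"
  shows "c = 0"
proof -
  have *: "\<not> 0 < d" if "thompson_x0_power d (\<lambda>n. n = 0) = (\<lambda>n. n = 0)" for d
  proof
    assume "0 < d"
    then have "(replicate (nat d) True \<frown> (\<lambda>n. n = 0)) (nat d) = (nat d = 0)"
      using that by (simp add: int_funpow_def thompson_x0_funpow)
    then show False
      using \<open>0 < d\<close> by simp
  qed
  have "thompson_x0_power (- c) (thompson_x0_power c x) = x" for x
    using int_funpow_add[OF thompson_x0_inverse, of "- c" c] by (simp add: int_funpow_0 fun_eq_iff)
  then have "thompson_x0_power (- c) (\<lambda>n. n = 0) = (\<lambda>n. n = 0)"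
    using assms by metis
  then show ?thesis
    using *[of c] *[of "- c"] assms by auto
qed

subsection \<open>Prefix codes\<close>

text \<open>A complete prefix code, phrased as a numbered partition of the Cantor set; the numbering
  matters because arithmetic is done on it.\<close>

definition prefix_code :: "nat \<Rightarrow> (nat \<Rightarrow> bool list) \<Rightarrow> bool" where
  "prefix_code M u \<longleftrightarrow> (\<forall>x. \<exists>!m. m < M \<and> x \<in> dyadic_subinterval (u m))"

lemma prefix_codeE:
  assumes "prefix_code M u"
  obtains m \<omega> where "m < M" "x = u m \<frown> \<omega>"
  using assms unfolding prefix_code_def by (metis dyadic_subintervalE)

lemma prefix_code_unique:
  assumes "prefix_code M u" "m < M" "l < M"
    and "x \<in> dyadic_subinterval (u m)" "x \<in> dyadic_subinterval (u l)"
  shows "m = l"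
  using assms unfolding prefix_code_def by blast

lemma prefix_code_pos: "prefix_code M u \<Longrightarrow> 0 < M"
  unfolding prefix_code_def by (metis gr0I not_less0)

text \<open>The first code splits off a unique word and the second then reads the tail. Numbering
  the pair \<open>(i, j)\<close> by \<open>i * k + j\<close> makes the second word the less
  significant digit.\<close>

lemma prefix_code_product:
  assumes "prefix_code M u" "prefix_code k w"
  shows "prefix_code (M * k) (\<lambda>m. u (m div k) @ w (m mod k))"
  unfolding prefix_code_def
proof
  fix x
  have "0 < k"
    using assms(2) by (rule prefix_code_pos)
  obtain i \<omega> where i: "i < M" "x = u i \<frown> \<omega>"
    using assms(1) by (rule prefix_codeE)
  obtain j \<psi> where j: "j < k" "\<omega> = w j \<frown> \<psi>"
    using assms(2) by (rule prefix_codeE)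
  show "\<exists>!m. m < M * k \<and> x \<in> dyadic_subinterval (u (m div k) @ w (m mod k))"
  proof (rule ex1I[of _ "i * k + j"])
    have "i * k + j < Suc i * k"
      using j by simp
    also have "\<dots> \<le> M * k"
      using i by (intro mult_le_mono1) simp
    finally show "i * k + j < M * k \<and>
        x \<in> dyadic_subinterval (u ((i * k + j) div k) @ w ((i * k + j) mod k))"
      using j i by simp
  next
    fix m assume m: "m < M * k \<and> x \<in> dyadic_subinterval (u (m div k) @ w (m mod k))"
    then have "m div k < M"
      by (simp add: less_mult_imp_div_less)
    then have 1: "m div k = i"
      using prefix_code_unique[OF assms(1), of "m div k" i x] i m
        dyadic_subinterval_appendD by fastforce
    then have "\<omega> \<in> dyadic_subinterval (w (m mod k))"
      using m i by (auto simp: dyadic_subinterval_def simp flip: conc_conc)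
    then have "m mod k = j"
      using prefix_code_unique[OF assms(2), of "m mod k" j \<omega>] j \<open>0 < k\<close> by simp
    then show "m = i * k + j"
      using 1 div_mult_mod_eq[of m k] by simp
  qed
qed

lemma prefix_code_reverse:
  assumes "prefix_code k w"
  shows "prefix_code k (\<lambda>j. w (k - 1 - j))"
  unfolding prefix_code_def
proof
  fix x
  obtain j \<omega> where j: "j < k" "x = w j \<frown> \<omega>"
    using assms by (rule prefix_codeE)
  show "\<exists>!j. j < k \<and> x \<in> dyadic_subinterval (w (k - 1 - j))"
  proof (rule ex1I[of _ "k - 1 - j"])
    fix i assume i: "i < k \<and> x \<in> dyadic_subinterval (w (k - 1 - i))"
    then have "k - 1 - i = j"
      using prefix_code_unique[OF assms, of "k - 1 - i" j x] j by simp
    then show "i = k - 1 - j"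
      using i by linarith
  qed (use j in auto)
qed

text \<open>The comb \<open>0\<close>, \<open>10\<close>, \<open>110\<close>, ..., whose last word
  consists of ones only: a complete prefix code of any positive size.\<close>

definition comb_word :: "nat \<Rightarrow> nat \<Rightarrow> bool list" where
  "comb_word k j = replicate j True @ (if Suc j < k then [False] else [])"

text \<open>A leading \<open>0\<close> is the first word; after a leading \<open>1\<close> the comb
  with one word fewer remains.\<close>

lemma prefix_code_comb_word: "prefix_code (Suc k) (comb_word (Suc k))"
proof (induction k)
  case 0
  then show ?case
    by (auto simp: prefix_code_def comb_word_def dyadic_subinterval_iff_nth)
next
  case (Suc k)
  have nil: "comb_word (Suc (Suc k)) 0 = [False]"
    by (simp add: comb_word_def)
  have step: "comb_word (Suc (Suc k)) (Suc j) = True # comb_word (Suc k) j" for j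
    by (simp add: comb_word_def)
  show ?case
    unfolding prefix_code_def
  proof
    fix x :: cantor
    show "\<exists>!m. m < Suc (Suc k) \<and> x \<in> dyadic_subinterval (comb_word (Suc (Suc k)) m)"
    proof (cases "x 0")
      case True
      have iff: "x \<in> dyadic_subinterval (True # v) \<longleftrightarrow> suffix 1 x \<in> dyadic_subinterval v" for v
        using True by (auto simp: dyadic_subinterval_iff_nth nth_Cons split: nat.splits)
      obtain j where j: "j < Suc k" "suffix 1 x \<in> dyadic_subinterval (comb_word (Suc k) j)"
        using Suc unfolding prefix_code_def by blast
      show ?thesis
      proof (rule ex1I[of _ "Suc j"])
        fix m assume m: "m < Suc (Suc k) \<and> x \<in> dyadic_subinterval (comb_word (Suc (Suc k)) m)"
        then obtain i where "m = Suc i"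
          using True by (cases m) (auto simp: nil dyadic_subinterval_iff_nth)
        then show "m = Suc j"
          using prefix_code_unique[OF Suc, of i j "suffix 1 x"] j m by (auto simp: step iff)
      qed (use j in \<open>simp add: step iff\<close>)
    next
      case False
      show ?thesis
      proof (rule ex1I[of _ 0])
        fix m assume m: "m < Suc (Suc k) \<and> x \<in> dyadic_subinterval (comb_word (Suc (Suc k)) m)"
        then show "m = 0"
          using False by (cases m) (auto simp: step dyadic_subinterval_iff_nth)
      qed (use False in \<open>auto simp: nil dyadic_subinterval_iff_nth\<close>)
    qed
  qed
qed

subsection \<open>Odometers with carry\<close>

lemma uniform_bound_lessThan:
  fixes P :: "nat \<Rightarrow> nat \<Rightarrow> bool"
  assumes "\<And>m. m < M \<Longrightarrow> \<exists>D. P m D" "\<And>m D E. P m D \<Longrightarrow> D \<le> E \<Longrightarrow> P m E"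
  shows "\<exists>D. \<forall>m<M. P m D"
  using assms(1)
proof (induction M)
  case (Suc M)
  then obtain D E where "\<forall>m<M. P m D" "P M E"
    by (metis less_Suc_eq)
  then have "\<forall>m<Suc M. P m (max D E)"
    using assms(2) by (metis less_Suc_eq max.cobounded1 max.cobounded2)
  then show ?case by blast
qed simp

text \<open>An action \<open>A\<close> of the integers, with a base point of trivial stabiliser,
  receives the carry in coordinate \<open>q\<close>, while counting takes place in coordinate
  \<open>p\<close>.\<close>

locale odometer =
  fixes p q :: "'n::finite" and A :: "int \<Rightarrow> cantor \<Rightarrow> cantor" and y\<^sub>0 :: cantor
  assumes p_neq_q: "p \<noteq> q"
    and A_0: "A 0 = id"
    and A_add: "A (c + d) = A c \<circ> A d"
    and cantor_affine_A: "\<exists>D. cantor_affine D (A c)"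
    and A_free: "A c y\<^sub>0 = y\<^sub>0 \<Longrightarrow> c = 0"
begin

text \<open>The overflow is not discarded but acts on \<open>q\<close>. Integer division rounds
  down, so negative \<open>r\<close> borrows correctly.\<close>

definition add_with_carry ::
    "nat \<Rightarrow> (nat \<Rightarrow> bool list) \<Rightarrow> int \<Rightarrow> 'n cantor_power \<Rightarrow> 'n cantor_power" where
  "add_with_carry M u r x =
     (let m = THE m. m < M \<and> x p \<in> dyadic_subinterval (u m); t = int m + r
      in x(p := u (nat (t mod int M)) \<frown> suffix (length (u m)) (x p), q := A (t div int M) (x q)))"

lemma add_with_carry_eq:
  assumes "prefix_code M u" "m < M" "x p = u m \<frown> \<omega>"
  shows "add_with_carry M u r x =
    x(p := u (nat ((int m + r) mod int M)) \<frown> \<omega>, q := A ((int m + r) div int M) (x q))"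
proof -
  have "(THE m. m < M \<and> x p \<in> dyadic_subinterval (u m)) = m"
    using assms prefix_code_unique[OF assms(1)] by (intro the_equality) auto
  then show ?thesis
    using assms(3) by (simp add: add_with_carry_def Let_def)
qed

text \<open>The two successive carries add up to the carry of the combined addition.\<close>

lemma add_with_carry_add:
  assumes "prefix_code M u"
  shows "add_with_carry M u (r + s) = add_with_carry M u r \<circ> add_with_carry M u s"
proof
  fix x
  obtain m \<omega> where m: "m < M" "x p = u m \<frown> \<omega>"
    using assms by (rule prefix_codeE)
  have "0 < int M"
    using m by simp
  define t where "t = int m + s"
  let ?y = "x(p := u (nat (t mod int M)) \<frown> \<omega>, q := A (t div int M) (x q))"
  have "add_with_carry M u s x = ?y"
    unfolding t_def using assms m by (rule add_with_carry_eq)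
  moreover have "add_with_carry M u r ?y =
      ?y(p := u (nat ((t mod int M + r) mod int M)) \<frown> \<omega>,
         q := A ((t mod int M + r) div int M) (?y q))"
    using add_with_carry_eq[OF assms, of "nat (t mod int M)" ?y \<omega> r] p_neq_q \<open>0 < int M\<close>
    by (simp add: nat_less_iff)
  moreover have "(t mod int M + r) mod int M = (int m + (r + s)) mod int M"
    by (simp add: t_def mod_add_left_eq add.assoc add.commute[of s r])
  moreover have "A ((t mod int M + r) div int M) (A (t div int M) z) = A ((int m + (r + s)) div int M) z" for z
  proof -
    have eq: "int m + (r + s) = (t mod int M + r) + t div int M * int M"
      by (simp add: t_def)
    have "int M \<noteq> 0"
      using m by simp
    then have "(t mod int M + r) div int M + t div int M = (int m + (r + s)) div int M"
      unfolding eq by (subst div_mult_self1) simp_all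
    then show ?thesis
      using A_add by (metis comp_apply)
  qed
  ultimately show "add_with_carry M u (r + s) x = (add_with_carry M u r \<circ> add_with_carry M u s) x"
    using add_with_carry_eq[of M u m x, OF assms m, of "r + s"] p_neq_q
    by (simp add: fun_upd_twist)
qed

text \<open>A multiple of \<open>M\<close> is pure carry. Hence adding \<open>1\<close> is an
  \<open>M\<close>-th root of \<open>A 1\<close> acting on \<open>q\<close>, whatever the
  code.\<close>

lemma add_with_carry_mult:
  assumes "prefix_code M u"
  shows "add_with_carry M u (int M * c) = (\<lambda>x. x(q := A c (x q)))"
proof
  fix x
  obtain m \<omega> where m: "m < M" "x p = u m \<frown> \<omega>"
    using assms by (rule prefix_codeE)
  then show "add_with_carry M u (int M * c) x = x(q := A c (x q))"
    using add_with_carry_eq[of M u m x, OF assms m, of "int M * c"] by (simp add: fun_upd_idem)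
qed

lemma add_with_carry_eq_id:
  assumes "prefix_code M u" "add_with_carry M u r = id"
  shows "r = 0"
proof -
  have "0 < M"
    using assms(1) by (rule prefix_code_pos)
  \<comment> \<open>Starting from code number \<open>0\<close>, the residue of \<open>r\<close>
    shows in \<open>p\<close>; its quotient shows in \<open>q\<close>, since
    \<open>y\<^sub>0\<close> is fixed by \<open>A c\<close> only for \<open>c = 0\<close>.\<close>
  define x where "x = (\<lambda>_. y\<^sub>0)(p := u 0 \<frown> y\<^sub>0)"
  have "x p = u 0 \<frown> y\<^sub>0"
    by (simp add: x_def)
  from add_with_carry_eq[of M u 0 x, OF assms(1) \<open>0 < M\<close> this, of r]
  have "x = x(p := u (nat (r mod int M)) \<frown> y\<^sub>0, q := A (r div int M) (x q))"
    using assms(2) by simp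
  then have eq: "x p = u (nat (r mod int M)) \<frown> y\<^sub>0" "x q = A (r div int M) (x q)"
    using p_neq_q by (metis fun_upd_apply)+
  have "0 = nat (r mod int M)"
    using prefix_code_unique[OF assms(1) \<open>0 < M\<close>, of "nat (r mod int M)" "x p"] eq(1) \<open>0 < M\<close>
    by (simp add: x_def nat_less_iff)
  moreover have "r div int M = 0"
    using eq(2) p_neq_q by (intro A_free) (simp add: x_def)
  ultimately show "r = 0"
    using \<open>0 < M\<close> div_mult_mod_eq[of r "int M"] pos_mod_sign[of "int M" r] by simp
qed

text \<open>Adding a multiple of \<open>k\<close> leaves the new last digit alone and adds
  \<open>r\<close> to the leading part. So adding \<open>1\<close> in the finer code is a
  \<open>k\<close>-th root of adding \<open>1\<close> in the coarser one.\<close>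

lemma add_with_carry_refine:
  assumes "prefix_code M u" "prefix_code k w"
  shows "add_with_carry (M * k) (\<lambda>m. u (m div k) @ w (m mod k)) (int k * r) = add_with_carry M u r"
proof
  fix x
  have "0 < k"
    using assms(2) by (rule prefix_code_pos)
  obtain i \<omega> where i: "i < M" "x p = u i \<frown> \<omega>"
    using assms(1) by (rule prefix_codeE)
  obtain j \<psi> where j: "j < k" "\<omega> = w j \<frown> \<psi>"
    using assms(2) by (rule prefix_codeE)
  have "i * k + j < Suc i * k"
    using j by simp
  also have "\<dots> \<le> M * k"
    using i by (intro mult_le_mono1) simp
  finally have less: "i * k + j < M * k" .
  let ?s = "int (i * k + j) + int k * r"
  have s: "?s = int k * (int i + r) + int j"
    by (simp add: algebra_simps)
  have "?s div int k = int i + r" "?s mod int k = int j"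
    unfolding s using j by simp_all
  \<comment> \<open>Division by \<open>M * k\<close> is carried out by \<open>k\<close> first, then
    by \<open>M\<close>.\<close>
  then have div: "?s div int (M * k) = (int i + r) div int M"
    and mod: "?s mod int (M * k) = int k * ((int i + r) mod int M) + int j"
    using zdiv_zmult2_eq[of "int M" ?s "int k"] zmod_zmult2_eq[of "int M" ?s "int k"]
    by (simp_all add: mult.commute)
  have nat_mod: "nat (?s mod int (M * k)) = k * nat ((int i + r) mod int M) + j"
    unfolding mod using i by (simp add: nat_add_distrib nat_mult_distrib)
  have "x p = (u ((i * k + j) div k) @ w ((i * k + j) mod k)) \<frown> \<psi>"
    using i j by simp
  from add_with_carry_eq[where x = x, OF prefix_code_product[OF assms] less this, of "int k * r"]
  show "add_with_carry (M * k) (\<lambda>m. u (m div k) @ w (m mod k)) (int k * r) x = add_with_carry M u r x"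
    using add_with_carry_eq[of M u i x, OF assms(1) i, of r] j unfolding div nat_mod by simp
qed

text \<open>Only finitely many code words and carries occur, so one depth \<open>D\<close> fixes
  both the code word in \<open>p\<close> and the action on \<open>q\<close>.\<close>

lemma locally_affine_add_with_carry:
  assumes "prefix_code M u"
  shows "\<exists>N. locally_affine N (add_with_carry M u r)"
proof -
  have "\<exists>D. \<forall>m<M. length (u m) \<le> D \<and> cantor_affine D (A ((int m + r) div int M))"
  proof (rule uniform_bound_lessThan)
    fix m
    obtain D where "cantor_affine D (A ((int m + r) div int M))"
      using cantor_affine_A by blast
    then show "\<exists>D. length (u m) \<le> D \<and> cantor_affine D (A ((int m + r) div int M))"
      by (intro exI[of _ "max D (length (u m))"]) (auto intro: cantor_affine_mono)
  qed (auto intro: cantor_affine_mono)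
  then obtain D where D: "\<And>m. m < M \<Longrightarrow> length (u m) \<le> D"
      "\<And>m. m < M \<Longrightarrow> cantor_affine D (A ((int m + r) div int M))"
    by blast
  have "locally_affine D (add_with_carry M u r)"
    unfolding locally_affine_def
  proof (intro allI impI)
    fix \<alpha> :: "'n \<Rightarrow> bool list" assume \<alpha>: "\<forall>j. D \<le> length (\<alpha> j)"
    \<comment> \<open>The tail of zeros is arbitrary: any point of the subblock reveals the code
      word with which \<open>\<alpha> p\<close> begins.\<close>
    obtain m \<psi> where m: "m < M" "\<alpha> p \<frown> (\<lambda>_. False) = u m \<frown> \<psi>"
      using assms by (rule prefix_codeE)
    have "\<alpha> p \<frown> (\<lambda>_. False) \<in> dyadic_subinterval (u m)" "length (u m) \<le> length (\<alpha> p)"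
      using m D(1)[OF m(1)] \<alpha> order_trans by auto
    then obtain \<gamma> where \<gamma>: "\<alpha> p = u m @ \<gamma>"
      by (rule conc_in_dyadic_subinterval_shorterE)
    obtain \<delta> where \<delta>: "\<And>\<omega>. A ((int m + r) div int M) (\<alpha> q \<frown> \<omega>) = \<delta> \<frown> \<omega>"
      using cantor_affineE[OF D(2)[OF m(1)]] \<alpha> by blast
    let ?\<beta> = "\<alpha>(p := u (nat ((int m + r) mod int M)) @ \<gamma>, q := \<delta>)"
    have "add_with_carry M u r (\<lambda>j. \<alpha> j \<frown> \<omega> j) = (\<lambda>j. ?\<beta> j \<frown> \<omega> j)" for \<omega>
      using add_with_carry_eq[OF assms m(1), of "\<lambda>j. \<alpha> j \<frown> \<omega> j" "\<gamma> \<frown> \<omega> p" r] p_neq_q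
      by (auto simp: \<gamma> \<delta> fun_eq_iff)
    then show "\<exists>\<beta>. \<forall>\<omega>. add_with_carry M u r (\<lambda>j. \<alpha> j \<frown> \<omega> j) = (\<lambda>j. \<beta> j \<frown> \<omega> j)"
      by blast
  qed
  then show ?thesis by blast
qed

end

subsection \<open>Mixed radix codes and copies of the rationals\<close>

text \<open>\<open>S\<close> changes the numbering of the words, not the set of words.\<close>

definition digit_word :: "nat set \<Rightarrow> nat \<Rightarrow> nat \<Rightarrow> bool list" where
  "digit_word S N j = comb_word (N + 3) (if N \<in> S then N + 2 - j else j)"

lemma prefix_code_digit_word: "prefix_code (N + 3) (digit_word S N)"
proof -
  have "prefix_code (N + 3) (comb_word (N + 3))"
    using prefix_code_comb_word[of "N + 2"] by (simp add: numeral_3_eq_3)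
  then show ?thesis
    using prefix_code_reverse[of "N + 3" "comb_word (N + 3)"]
    by (cases "N \<in> S") (simp_all add: digit_word_def[abs_def])
qed

text \<open>
  Mixed radix numerals below \<open>(N + 2)!\<close>, least significant digit last; \<open>S\<close> selects the positions
  at which the order of the digits is reversed.
\<close>

fun radix_word :: "nat set \<Rightarrow> nat \<Rightarrow> nat \<Rightarrow> bool list" where
  "radix_word S 0 = comb_word 2"
| "radix_word S (Suc N) =
     (\<lambda>m. radix_word S N (m div (N + 3)) @ digit_word S N (m mod (N + 3)))"

lemma fact_Suc_add_2: "fact (Suc N + 2) = fact (N + 2) * (N + 3 :: nat)"
  by (simp add: algebra_simps)

lemma prefix_code_radix_word: "prefix_code (fact (N + 2)) (radix_word S N)"
proof (induction N)
  case 0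
  then show ?case
    using prefix_code_comb_word[of 1] by (simp add: numeral_2_eq_2)
next
  case (Suc N)
  show ?case
    unfolding fact_Suc_add_2 radix_word.simps
    using Suc prefix_code_digit_word by (rule prefix_code_product)
qed

lemma radix_word_cong:
  assumes "\<And>i. i < N \<Longrightarrow> i \<in> S \<longleftrightarrow> i \<in> T"
  shows "radix_word S N = radix_word T N"
  using assms by (induction N) (auto simp: digit_word_def)

section \<open>Clearing denominators by factorials\<close>

lemma rat_mult_fact_int:
  fixes r :: rat
  assumes "nat (snd (quotient_of r)) \<le> N"
  obtains t where "r * fact N = of_int t"
proof -
  obtain a b where ab: "quotient_of r = (a, b)" by fastforce
  have "0 < b"
    using quotient_of_denom_pos[OF ab] .
  have "nat b dvd fact N"
    using assms \<open>0 < b\<close> ab by (intro dvd_fact) auto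
  then obtain k where k: "fact N = nat b * k" by (rule dvdE)
  have "(fact N :: rat) = of_nat (fact N)"
    by simp
  also have "\<dots> = of_int b * of_nat k"
    unfolding k using \<open>0 < b\<close> by simp
  finally have "r * fact N = of_int (a * int k)"
    using quotient_of_div[OF ab] \<open>0 < b\<close> by simp
  then show ?thesis by (rule that)
qed

lemma rats_mult_fact_int:
  fixes r s :: rat
  obtains N t u where "r * fact (N + 2) = of_int t" "s * fact (N + 2) = of_int u"
proof -
  let ?N = "nat (snd (quotient_of r)) + nat (snd (quotient_of s))"
  show ?thesis
    using rat_mult_fact_int[of r "?N + 2"] rat_mult_fact_int[of s "?N + 2"] that[of ?N]
    by (metis le_add1 le_add2 add.assoc le_trans)
qed

context odometer
begin

definition radix_add :: "nat set \<Rightarrow> nat \<Rightarrow> int \<Rightarrow> 'n cantor_power \<Rightarrow> 'n cantor_power" where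
  "radix_add S N = add_with_carry (fact (N + 2)) (radix_word S N)"

text \<open>Each level thus contains the previous one, so the cyclic groups form an increasing
  chain.\<close>

lemma radix_add_Suc: "radix_add S (Suc N) (int (N + 3) * t) = radix_add S N t"
  unfolding radix_add_def fact_Suc_add_2 radix_word.simps
  using prefix_code_radix_word prefix_code_digit_word by (rule add_with_carry_refine)

text \<open>Independence of the level: one step up multiplies the integer by \<open>L + 3\<close>,
  which \<open>radix_add_Suc\<close> absorbs.\<close>

lemma radix_add_lift:
  fixes r :: rat
  assumes "r * fact (N + 2) = of_int t" "N \<le> L" "r * fact (L + 2) = of_int u"
  shows "radix_add S L u = radix_add S N t"
  using assms(2,3)
proof (induction L arbitrary: u rule: dec_induct)
  case base
  then show ?case
    using assms(1) by simp
next
  case (step L)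
  \<comment> \<open>The induction hypothesis needs \<open>r\<close> to be integral at level
    \<open>L\<close>, which follows from divisibility of factorials.\<close>
  have "N + 2 \<le> L + 2" using step by simp
  then have "(fact (N + 2) :: nat) dvd fact (L + 2)"
    by (rule fact_dvd)
  then obtain k where k: "(fact (L + 2) :: nat) = fact (N + 2) * k" by (rule dvdE)
  have "(fact (L + 2) :: rat) = of_nat (fact (L + 2))"
    by (simp only: of_nat_fact)
  also have "\<dots> = fact (N + 2) * of_nat k"
    unfolding k by (simp only: of_nat_mult of_nat_fact)
  finally have L: "r * fact (L + 2) = of_int (t * int k)"
    using assms(1) by (simp del: fact_Suc flip: mult.assoc)
  have "(fact (Suc L + 2) :: rat) = of_nat (fact (Suc L + 2))"
    by (simp only: of_nat_fact)
  also have "\<dots> = fact (L + 2) * of_nat (L + 3)"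
    unfolding fact_Suc_add_2 by (simp only: of_nat_mult of_nat_fact)
  finally have Suc_L: "(fact (Suc L + 2) :: rat) = fact (L + 2) * of_nat (L + 3)" .
  have "of_int u = r * fact (L + 2) * of_nat (L + 3)"
    using step.prems by (simp only: Suc_L mult.assoc)
  also have "\<dots> = of_int (int (L + 3) * (t * int k))"
    unfolding L by simp
  finally have "u = int (L + 3) * (t * int k)"
    by (simp only: of_int_eq_iff)
  then show ?case
    using step.IH[OF L] radix_add_Suc by simp
qed

text \<open>The denominator of \<open>r\<close> serves as level: it divides
  \<open>fact (N + 2)\<close>, so the floor is exact and only converts to
  \<open>int\<close>.\<close>

definition rat_power :: "nat set \<Rightarrow> rat \<Rightarrow> 'n cantor_power \<Rightarrow> 'n cantor_power" where
  "rat_power S r =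
     (let N = nat (snd (quotient_of r)) in radix_add S N \<lfloor>r * fact (N + 2)\<rfloor>)"

text \<open>Both levels are compared with their sum.\<close>

lemma rat_power_eq:
  assumes "r * fact (N + 2) = of_int t"
  shows "rat_power S r = radix_add S N t"
proof -
  let ?N = "nat (snd (quotient_of r))"
  obtain t' where t': "r * fact (?N + 2) = of_int t'"
    by (rule rat_mult_fact_int[of r "?N + 2"]) auto
  obtain u where u: "r * fact (?N + N + 2) = of_int u"
    by (rule rat_mult_fact_int[of r "?N + N + 2"]) auto
  have "rat_power S r = radix_add S ?N t'"
    by (simp only: rat_power_def Let_def t' floor_of_int)
  also have "\<dots> = radix_add S (?N + N) u"
    using radix_add_lift[OF t' _ u] by simp
  also have "\<dots> = radix_add S N t"
    using radix_add_lift[OF assms _ u] by simp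
  finally show ?thesis .
qed

lemma rat_power_add: "rat_power S (r + s) = rat_power S r \<circ> rat_power S s"
proof -
  obtain N t u where *: "r * fact (N + 2) = of_int t" "s * fact (N + 2) = of_int u"
    by (rule rats_mult_fact_int)
  then have "(r + s) * fact (N + 2) = of_int (t + u)"
    by (simp only: distrib_right of_int_add)
  then show ?thesis
    using add_with_carry_add[OF prefix_code_radix_word]
    by (simp only: rat_power_eq[OF *(1)] rat_power_eq[OF *(2)] rat_power_eq radix_add_def)
qed

text \<open>The right-hand side is free of \<open>S\<close>: these powers form the shared copy of
  the integers.\<close>

lemma rat_power_of_int: "rat_power S (of_int c) = (\<lambda>x. x(q := A c (x q)))"
proof -
  have "rat_power S (of_int c) = radix_add S 0 (int (fact (0 + 2)) * c)"
    by (rule rat_power_eq) simp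
  also have "\<dots> = (\<lambda>x. x(q := A c (x q)))"
    unfolding radix_add_def using prefix_code_radix_word by (rule add_with_carry_mult)
  finally show ?thesis .
qed

lemma rat_power_0: "rat_power S 0 = id"
  using rat_power_of_int[of S 0] by (simp add: A_0 fun_eq_iff)

lemma inj_rat_power: "inj (rat_power S)"
proof (rule injI)
  fix r s assume eq: "rat_power S r = rat_power S s"
  obtain N t where t: "(r - s) * fact (N + 2) = of_int t"
    using rats_mult_fact_int[of "r - s" 0] by blast
  have "rat_power S (r - s) = rat_power S (- s) \<circ> rat_power S r"
    using rat_power_add[of S "- s" r] by simp
  also have "\<dots> = id"
    using rat_power_add[of S "- s" s] by (simp add: eq rat_power_0)
  finally have "t = 0"
    using add_with_carry_eq_id[OF prefix_code_radix_word[of N S], of t] rat_power_eq[OF t, of S]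
    by (simp add: radix_add_def)
  then show "r = s"
    using t by (simp del: fact_Suc)
qed

lemma locally_affine_rat_power: "\<exists>N. locally_affine N (rat_power S r)"
proof -
  obtain N t where t: "r * fact (N + 2) = of_int t"
    using rats_mult_fact_int[of r 0] by blast
  show ?thesis
    unfolding rat_power_eq[OF t] radix_add_def
    using prefix_code_radix_word by (rule locally_affine_add_with_carry)
qed

section \<open>Separating the groups for different digit orders\<close>

lemma rat_power_of_nat_mult: "rat_power S (of_nat n * r) = rat_power S r ^^ n"
  by (induction n) (simp_all add: rat_power_0 rat_power_add algebra_simps)

text \<open>The same word \<open>radix_word S N 0 @ comb_word (N + 3) 0\<close> has number
  \<open>0\<close> for \<open>S\<close> but \<open>N + 2\<close> for \<open>T\<close>. Adding
  \<open>1\<close> carries into the leading part only for \<open>T\<close>.\<close>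

lemma radix_add_differ:
  assumes "N \<notin> S" "N \<in> T" "\<And>i. i < N \<Longrightarrow> i \<in> S \<longleftrightarrow> i \<in> T"
  shows "radix_add S (Suc N) 1 \<noteq> radix_add T (Suc N) 1"
proof
  assume eq: "radix_add S (Suc N) 1 = radix_add T (Suc N) 1"
  let ?k = "N + 3" and ?M = "fact (Suc N + 2) :: nat" and ?u = "radix_word S N"
  \<comment> \<open>With at least two leading numerals, the carry out of the last digit does not
    overflow past the code.\<close>
  have "(2::nat) \<le> fact (N + 2)"
    using fact_mono[of 2 "N + 2", where 'a = nat] by simp
  then have "2 * ?k \<le> ?M"
    unfolding fact_Suc_add_2 by (rule mult_le_mono1)
  then have less: "a < ?M" if "a \<le> N + 3" for a
    using that by (intro less_le_trans[OF _ \<open>2 * ?k \<le> ?M\<close>]) simp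
  define x where "x = (\<lambda>_::'n. (?u 0 @ comb_word ?k 0) \<frown> y\<^sub>0)"
  have S: "x p = radix_word S (Suc N) 0 \<frown> y\<^sub>0" and T: "x p = radix_word T (Suc N) (N + 2) \<frown> y\<^sub>0"
    using assms(1,2) radix_word_cong[OF assms(3)] by (simp_all add: x_def digit_word_def)
  have "0 < ?M" "1 < ?M" "N + 2 < ?M" "?k < ?M"
    by (rule less; simp)+
  then have "nat ((int 0 + 1) mod int ?M) = 1" "nat ((int (N + 2) + 1) mod int ?M) = ?k"
    by (simp_all del: fact_Suc of_nat_fact add: mod_pos_pos_trivial)
  then have "radix_add S (Suc N) 1 x p \<in> dyadic_subinterval (?u 0)"
    "radix_add T (Suc N) 1 x p \<in> dyadic_subinterval (?u 1)"
    unfolding radix_add_def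
      add_with_carry_eq[of _ _ 0 x, OF prefix_code_radix_word \<open>0 < ?M\<close> S]
      add_with_carry_eq[of _ _ "N + 2" x, OF prefix_code_radix_word \<open>N + 2 < ?M\<close> T]
    using p_neq_q radix_word_cong[OF assms(3)]
    by (simp_all del: fact_Suc of_nat_fact flip: conc_conc)
  then show False
    using prefix_code_unique[OF prefix_code_radix_word[of N S], of 0 1] \<open>2 \<le> fact (N + 2)\<close> eq
    by simp
qed

text \<open>If the ranges agree, a root of the common map in one group lies in the other, where
  roots are unique; so both groups have the same root, contrary to
  \<open>radix_add_differ\<close>.\<close>

lemma inj_range_rat_power: "inj (\<lambda>S. range (rat_power S))"
proof (rule injI, rule ccontr)
  fix S T assume range: "range (rat_power S) = range (rat_power T)" and "S \<noteq> T"
  define N where "N = (LEAST N. (N \<in> S) \<noteq> (N \<in> T))"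
  have N: "(N \<in> S) \<noteq> (N \<in> T)"
    using LeastI_ex[of "\<lambda>N. (N \<in> S) \<noteq> (N \<in> T)"] \<open>S \<noteq> T\<close> unfolding N_def by blast
  have below: "i \<in> S \<longleftrightarrow> i \<in> T" if "i < N" for i
    using that not_less_Least[of i "\<lambda>N. (N \<in> S) \<noteq> (N \<in> T)"] by (simp add: N_def)
  \<comment> \<open>The exponent whose power is adding \<open>1\<close> at level
    \<open>Suc N\<close>, the first level affected by the digit order at \<open>N\<close>.\<close>
  define r :: rat where "r = 1 / fact (Suc N + 2)"
  have n: "of_nat (fact (Suc N + 2)) * r = 1"
    by (simp add: r_def del: fact_Suc)
  obtain s where s: "rat_power S r = rat_power T s"
    using range by blast
  have "rat_power T (of_nat (fact (Suc N + 2)) * s) = rat_power S (of_nat (fact (Suc N + 2)) * r)"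
    by (simp only: rat_power_of_nat_mult s)
  also have "\<dots> = rat_power T (of_nat (fact (Suc N + 2)) * r)"
    unfolding n using rat_power_of_int[of _ 1] by simp
  finally have "of_nat (fact (Suc N + 2)) * s = of_nat (fact (Suc N + 2)) * r"
    using inj_rat_power by (simp only: inj_eq)
  then have "s = r"
    by (simp del: fact_Suc)
  moreover have "r * fact (Suc N + 2) = of_int 1"
    by (simp add: r_def del: fact_Suc)
  ultimately have "radix_add S (Suc N) 1 = radix_add T (Suc N) 1"
    using s by (simp only: rat_power_eq)
  then show False
    using N below radix_add_differ[of N S T] radix_add_differ[of N T S] by metis
qed

end

theorem theorem1p2:
  fixes nV :: "('n::finite cantor_power \<Rightarrow> 'n cantor_power) monoid"
  assumes "CARD('n) \<ge> 2"
    and "nV = brin_thompson"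
  shows "\<exists>Z. subgroup Z nV \<and> nV\<lparr>carrier := Z\<rparr> \<cong> integer_group \<and>
           (\<exists>\<Q> :: ('n cantor_power \<Rightarrow> 'n cantor_power) set set.
              \<Q> \<approx> (UNIV :: nat set set) \<and>
              (\<forall>Q\<in>\<Q>. subgroup Q nV \<and> nV\<lparr>carrier := Q\<rparr> \<cong> rational_group \<and> Z \<subseteq> Q))"
proof -
  obtain p q :: 'n where "p \<noteq> q"
    using assms(1) card_le_Suc0_iff_eq[of "UNIV :: 'n set"] by fastforce
  then interpret odometer p q thompson_x0_power "\<lambda>n. n = 0"
    by unfold_locales
      (simp_all add: int_funpow_0 int_funpow_add[OF thompson_x0_inverse]
        cantor_affine_thompson_x0_power thompson_x0_power_fixes_imp_0)
  \<comment> \<open>Using \<open>{}\<close> is immaterial, by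
    \<open>rat_power_of_int\<close>.\<close>
  define Z where "Z = range (\<lambda>c. rat_power {} (of_int c))"
  have "inj (\<lambda>c. rat_power {} (of_int c))"
    using injD[OF inj_rat_power] by (intro injI) fastforce
  then have Z: "subgroup Z brin_thompson" "brin_thompson\<lparr>carrier := Z\<rparr> \<cong> integer_group"
    unfolding Z_def
    by (intro subgroup_range_brin_thompson[OF abelian_integer_group];
        simp add: locally_affine_rat_power rat_power_0 rat_power_add)+
  have Q: "subgroup (range (rat_power S)) brin_thompson"
    "brin_thompson\<lparr>carrier := range (rat_power S)\<rparr> \<cong> rational_group" for S
    by (intro subgroup_range_brin_thompson[OF comm_group_rational_group];
        simp add: locally_affine_rat_power rat_power_0 rat_power_add inj_rat_power rational_group_def)+
  have "Z \<subseteq> range (rat_power S)" for S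
    unfolding Z_def rat_power_of_int[of "{}"] by (auto simp flip: rat_power_of_int[of S])
  moreover have "range (\<lambda>S. range (rat_power S)) \<approx> (UNIV :: nat set set)"
    using inj_range_rat_power by (rule inj_on_image_eqpoll_self)
  ultimately show ?thesis
    unfolding assms(2) using Z Q
    by (intro exI[of _ Z] conjI exI[of _ "range (\<lambda>S. range (rat_power S))"]) auto
qed

end
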